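(* Let $(\mathcal{X},d)$ be a metric space, let $f,g:\mathcal{X}\to\mathcal{X}$ be maps and $F,G:\mathcal{X}\to\mathcal{P}_{fb}(\mathcal{X})$ be set-valued maps such that the pairs $\{f,F\}$ and $\{g,G\}$ are occasionally weakly compatible. Let $\varphi:(\mathbb{R}^+)^5\to\mathbb{R}$ be a function, written $\varphi(t_1,\dots,t_5)$, such that: (i) $\varphi$ is nonincreasing in the variables $t_4$ and $t_5$; (ii) $\varphi(t,0,0,t,t)\ge 0$ for all $t>0$. Suppose that for all $x,y\in\mathcal{X}$ for which $\max\{d(fx,gy),d(fx,Fx),d(gy,Gy)\}>0$, $$\varphi\big(d(fx,gy),\,d(fx,Fx),\,d(gy,Gy),\,d(fx,Gy),\,d(gy,Fx)\big)<0 .$$ Then $f$, $g$, $F$ and $G$ have a unique common fixed point.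
   Context: $\mathcal{P}_{fb}(\mathcal{X})$ is the class of all nonempty bounded closed subsets of $\mathcal{X}$. $\mathbb{R}^+=[0,\infty)$. We write $fx=f(x)$, $Fx=F(x)$, and for $x\in\mathcal{X}$, $A\subseteq\mathcal{X}$, $d(x,A)=\inf\{d(x,y):y\in A\}$. A pair $\{f,F\}$ with $f:\mathcal{X}\to\mathcal{X}$ and $F:\mathcal{X}\to\mathcal{P}_{fb}(\mathcal{X})$ is occasionally weakly compatible (owc) if there exists $x\in\mathcal{X}$ such that $fx\in Fx$ and $fFx\subseteq Ffx$, where $fFx=\{f(y):y\in F(x)\}$ and $Ffx=F(f(x))$. A common fixed point of $f,g,F,G$ is a point $w\in\mathcal{X}$ with $w=fw=gw$, $w\in Fw$ and $w\in Gw$. *)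

theory Defs
  imports "HOL-Analysis.Analysis"
begin

definition P_fb :: "'a::metric_space set set" where
  "P_fb = {A. A \<noteq> {} \<and> bounded A \<and> closed A}"

definition owc :: "('a \<Rightarrow> 'a) \<Rightarrow> ('a \<Rightarrow> 'a set) \<Rightarrow> bool" where
  "owc f F \<longleftrightarrow> (\<exists>x. f x \<in> F x \<and> f ` F x \<subseteq> F (f x))"

definition common_fixed_point ::
    "('a \<Rightarrow> 'a) \<Rightarrow> ('a \<Rightarrow> 'a) \<Rightarrow> ('a \<Rightarrow> 'a set) \<Rightarrow> ('a \<Rightarrow> 'a set) \<Rightarrow> 'a \<Rightarrow> bool" where
  "common_fixed_point f g F G w \<longleftrightarrow> w = f w \<and> w = g w \<and> w \<in> F w \<and> w \<in> G w"

end

theory Submission imports Defs begin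

text \<open>If \<open>f x \<in> F x\<close> and \<open>g y \<in> G y\<close> with \<open>t = d(f x, g y) > 0\<close>, then \<open>d(f x, G y)\<close> and
  \<open>d(g y, F x)\<close> are at most \<open>t\<close>, so monotonicity turns the contractive condition into
  \<open>\<phi>(t, 0, 0, t, t) < 0\<close>, a contradiction. Hence any coincidence value of the first pair equals any
  coincidence value of the second. Occasional weak compatibility makes the images \<open>f u\<close>, \<open>g v\<close> of
  suitable coincidence points coincidence points again, and comparing values gives the result.\<close>

theorem theorem2p2:
  fixes f g :: "'a::metric_space \<Rightarrow> 'a"
    and F G :: "'a \<Rightarrow> 'a set"
    and \<phi> :: "real \<Rightarrow> real \<Rightarrow> real \<Rightarrow> real \<Rightarrow> real \<Rightarrow> real"
  assumes F_fb: "\<And>x. F x \<in> P_fb"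
    and G_fb: "\<And>x. G x \<in> P_fb"
    and owc_fF: "owc f F"
    and owc_gG: "owc g G"
    and phi_antimono4: "\<And>t1 t2 t3 t5. t1 \<ge> 0 \<Longrightarrow> t2 \<ge> 0 \<Longrightarrow> t3 \<ge> 0 \<Longrightarrow> t5 \<ge> 0 \<Longrightarrow>
          antimono_on {0..} (\<lambda>t4. \<phi> t1 t2 t3 t4 t5)"
    and phi_antimono5: "\<And>t1 t2 t3 t4. t1 \<ge> 0 \<Longrightarrow> t2 \<ge> 0 \<Longrightarrow> t3 \<ge> 0 \<Longrightarrow> t4 \<ge> 0 \<Longrightarrow>
          antimono_on {0..} (\<lambda>t5. \<phi> t1 t2 t3 t4 t5)"
    and phi_nonneg: "\<And>t. t > 0 \<Longrightarrow> \<phi> t 0 0 t t \<ge> 0"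
    and contr: "\<And>x y. max (dist (f x) (g y)) (max (infdist (f x) (F x)) (infdist (g y) (G y))) > 0 \<Longrightarrow>
          \<phi> (dist (f x) (g y)) (infdist (f x) (F x)) (infdist (g y) (G y))
            (infdist (f x) (G y)) (infdist (g y) (F x)) < 0"
  shows "\<exists>!w. common_fixed_point f g F G w"
proof -
  have coincide: "f x = g y" if fx: "f x \<in> F x" and gy: "g y \<in> G y" for x y
  proof (rule ccontr)
    let ?t = "dist (f x) (g y)" and ?a = "infdist (f x) (G y)" and ?b = "infdist (g y) (F x)"
    assume "f x \<noteq> g y"
    then have t: "?t > 0" by simp
    have a: "?a \<le> ?t" using gy by (rule infdist_le)
    have b: "?b \<le> ?t" using infdist_le[OF fx, of "g y"] by (simp add: dist_commute)
    have "0 \<le> \<phi> ?t 0 0 ?t ?t" using t by (rule phi_nonneg)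
    also have "\<dots> \<le> \<phi> ?t 0 0 ?a ?t"
      using phi_antimono4[of ?t 0 0 ?t] a by (auto elim!: monotone_onD simp: infdist_nonneg)
    also have "\<dots> \<le> \<phi> ?t 0 0 ?a ?b"
      using phi_antimono5[of ?t 0 0 ?a] b by (auto elim!: monotone_onD simp: infdist_nonneg)
    \<comment> \<open>Membership makes the second and third arguments in \<open>contr\<close>
      vanish, and \<open>t\<close> makes the maximum positive.\<close>
    also have "\<dots> < 0"
      using contr[of x y] t fx gy by simp
    finally show False by simp
  qed
  \<comment> \<open>The inclusion in \<open>owc\<close> is applied to the element \<open>f u\<close>
    of \<open>F u\<close>.\<close>
  obtain u where u: "f u \<in> F u" "f (f u) \<in> F (f u)"
    using owc_fF unfolding owc_def by blast
  obtain v where v: "g v \<in> G v" "g (g v) \<in> G (g v)"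
    using owc_gG unfolding owc_def by blast
  \<comment> \<open>Compare \<open>(u, v)\<close>, \<open>(f u, v)\<close> and
    \<open>(u, g v)\<close>: both \<open>f\<close> and \<open>g\<close> then fix
    \<open>f u = g v\<close>.\<close>
  have "f u = g v" "f (f u) = g v" "f u = g (g v)"
    using coincide u v by blast+
  then have w: "common_fixed_point f g F G (f u)"
    using u v unfolding common_fixed_point_def by simp
  show ?thesis
  proof (rule ex1I)
    show "common_fixed_point f g F G (f u)" by (rule w)
  next
    fix z assume "common_fixed_point f g F G z"
    \<comment> \<open>With \<open>z\<close> on the \<open>f\<close> side and \<open>f u\<close> on
      the \<open>g\<close> side, \<open>z = f z = g (f u) = f u\<close>.\<close>
    then show "z = f u"
      using coincide[of z "f u"] w unfolding common_fixed_point_def by simp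
  qed
qed

end
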